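(* Let $\mathfrak{Z}$ be an $\mathbb{F}$-Fréchet space. Assume, for $i=1,2$, that $\xi_i$ are integrators with measures $\mu_i$ on the measurable spaces $(M_i,\mathcal{M}_i)$ and with maps $\Xi_i$. Assume there exist $\Xi_{1,x},\Xi_{2,y}\in L(\mathfrak{Z}',\sigma)$, $x\in M_1$, $y\in M_2$, such that $\Xi_1(\eta)(x)=\Xi_{1,x}(\eta(x))$ for all $\eta:M_1\to\mathfrak{Z}'$, $x\in M_1$, and $\Xi_2(\eta)(y)=\Xi_{2,y}(\eta(y))$ for all $\eta:M_2\to\mathfrak{Z}'$, $y\in M_2$. Consider a mapping $$M_1\times M_2\ni(x,y)\mapsto\gamma(x,y)\in\mathfrak{Z}',$$ where $\gamma(x,\cdot)\in\mathcal{I}(\xi_2)$ for any $x\in M_1$, $\gamma(\cdot,y)\in\mathcal{I}(\xi_1)$ for any $y\in M_2$, and $\int_{E_2}\gamma(\cdot,y)\,d\xi_2(y)\in\mathcal{I}(\xi_1)$ and $\int_{E_1}\gamma(x,\cdot)\,d\xi_1(x)\in\mathcal{I}(\xi_2)$ for any $E_i\in\mathcal{M}_i$, $i=1,2$. If $\Xi_{1,x}$ and $\Xi_{2,y}$ commute, that is, $$\Xi_{1,x}(\Xi_{2,y}(\gamma(x,y)))=\Xi_{2,y}(\Xi_{1,x}(\gamma(x,y))),\quad(x,y)\in M_1\times M_2,$$ with $(x,y)\mapsto\Xi_{1,x}(\Xi_{2,y}(\gamma(x,y)))$ being $\mathfrak{Z}'$-Gelfand $\mu_1\times\mu_2$-integrable,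 then $$\int_{E_1}\int_{E_2}\gamma(x,y)\,d\xi_2(y)\,d\xi_1(x)=\int_{E_2}\int_{E_1}\gamma(x,y)\,d\xi_1(x)\,d\xi_2(y)$$ for any $E_i\in\mathcal{M}_i$, $i=1,2$.
   Context: $\mathbb{F}\in\{\mathbb{R},\mathbb{C}\}$. A Fréchet space is a metrizable, complete, locally convex topological vector space over $\mathbb{F}$; $\mathfrak{Z}'$ is its topological dual and $\langle z',z\rangle$ the dual pairing. $\sigma(\mathfrak{Z}',\mathfrak{Z})$ is the weak star topology on $\mathfrak{Z}'$, i.e. the coarsest topology making all maps $z'\mapsto\langle z',z\rangle$, $z\in\mathfrak{Z}$, continuous. $L(\mathfrak{Z}',\sigma)$ is the space of linear, $\sigma(\mathfrak{Z}',\mathfrak{Z})$-$\sigma(\mathfrak{Z}',\mathfrak{Z})$ continuous operators on $\mathfrak{Z}'$. For a $\sigma$-finite measure space $(M,\mathcal{M},\mu)$, a map $\psi:M\to\mathfrak{Z}'$ is $\mathfrak{Z}'$-Gelfand $\mu$-integrable if $x\mapsto\langle\psi(x),z\rangle\in L^1(\mu)$ for every $z\in\mathfrak{Z}$. For such $\psi$ and $E\in\mathcal{M}$, the Gelfand integral $\int_E\psi(x)\,\mu(dx)$ is the element of $\mathfrak{Z}'$ given by $z\mapsto\int_E\langle\psi(x),z\rangle\,\mu(dx)$ (this functional is continuous). Let $\mathcal{F}(M,\mathfrak{Z}')$ be the set of maps from $M$ to $\mathfrak{Z}'$. Given a measurable space $(M,\mathcal{M})$, a map $\xi:\mathcal{M}\to\mathfrak{Z}'$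 is an integrator (with measure $\mu$ and map $\Xi$) if there exist a $\sigma$-finite measure $\mu$ on $(M,\mathcal{M})$, a map $\Xi:\mathcal{F}(M,\mathfrak{Z}')\to\mathcal{F}(M,\mathfrak{Z}')$, and an element $u\in\mathfrak{Z}'$ (the unit element, regarded as the constant map $x\mapsto u$) such that $\Xi(u)$ is $\mathfrak{Z}'$-Gelfand $\mu$-integrable and $\xi(E)=\int_E\Xi(u)(x)\,\mu(dx)$ for all $E\in\mathcal{M}$. A map $\gamma:M\to\mathfrak{Z}'$ is integrable with respect to $\xi$, written $\gamma\in\mathcal{I}(\xi)$, if $\Xi(\gamma)$ is $\mathfrak{Z}'$-Gelfand $\mu$-integrable; then for $E\in\mathcal{M}$, $\int_E\gamma(x)\,d\xi(x):=\int_E\Xi(\gamma)(x)\,\mu(dx)\in\mathfrak{Z}'$. *)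

theory Defs
  imports "HOL-Analysis.Analysis"
begin

text \<open>
  The scalar field is a type \<open>'f\<close> of sort \<open>{real_normed_field, banach, second_countable_topology}\<close>.
  Both \<^typ>\<open>real\<close> and \<^typ>\<open>complex\<close> have this sort, and since the norm of a
  \<^class>\<open>real_normed_field\<close> is multiplicative, they are its only members up to isometric
  isomorphism (Ostrowski, Gelfand-Mazur).

  The class \<^class>\<open>uniform_topological_group_add\<close> forces the uniformity of \<open>'z\<close> to be the canonical
  one given by its topology and addition, so that \<^const>\<open>complete\<close> is completeness as a topological
  vector space (convergence of Cauchy filters).
\<close>

locale frechet_space = vector_space scl
  for scl :: "'f::{real_normed_field, banach, second_countable_topology}
    \<Rightarrow> 'z::{uniform_topological_group_add, ab_group_add} \<Rightarrow> 'z" +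
  assumes continuous_scl: "continuous_on UNIV (\<lambda>(c, z). scl c z)"
    and locally_convex: "\<And>U. open U \<Longrightarrow> 0 \<in> U \<Longrightarrow>
      \<exists>V. open V \<and> 0 \<in> V \<and> V \<subseteq> U \<and>
        (\<forall>v\<in>V. \<forall>w\<in>V. \<forall>t\<in>{0..1::real}. scl (of_real (1 - t)) v + scl (of_real t) w \<in> V)"
    and metrizable: "metrizable_space (euclidean :: 'z topology)"
    and complete_space: "complete (UNIV :: 'z set)"

text \<open>
  The pairing of \<open>\<phi>\<close> in the dual with \<open>z\<close> is the application \<open>\<phi> z\<close>.
\<close>

definition top_dual ::
  "('f::real_normed_field \<Rightarrow> 'z::{topological_space, ab_group_add} \<Rightarrow> 'z) \<Rightarrow> ('z \<Rightarrow> 'f) set" where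
  "top_dual scl = {\<phi>. Vector_Spaces.linear scl (*) \<phi> \<and> continuous_on UNIV \<phi>}"

definition weak_star ::
  "('f::real_normed_field \<Rightarrow> 'z::{topological_space, ab_group_add} \<Rightarrow> 'z) \<Rightarrow> ('z \<Rightarrow> 'f) topology" where
  "weak_star scl =
    topology_generated_by {{\<phi> \<in> top_dual scl. \<phi> z \<in> U} | z U. open U}"

text \<open>
  Only the values of an operator on the dual matter; continuity between the weak star topologies
  includes that it maps the dual into itself.
\<close>

definition weak_star_operators ::
  "('f::real_normed_field \<Rightarrow> 'z::{topological_space, ab_group_add} \<Rightarrow> 'z)
    \<Rightarrow> (('z \<Rightarrow> 'f) \<Rightarrow> ('z \<Rightarrow> 'f)) set" where
  "weak_star_operators scl =
    {T. continuous_map (weak_star scl) (weak_star scl) T \<and>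
      (\<forall>\<phi>\<in>top_dual scl. \<forall>\<psi>\<in>top_dual scl. T (\<lambda>z. \<phi> z + \<psi> z) = (\<lambda>z. T \<phi> z + T \<psi> z)) \<and>
      (\<forall>c. \<forall>\<phi>\<in>top_dual scl. T (\<lambda>z. c * \<phi> z) = (\<lambda>z. c * T \<phi> z))}"

definition gelfand_integrable ::
  "('f::{real_normed_field, banach, second_countable_topology}
      \<Rightarrow> 'z::{topological_space, ab_group_add} \<Rightarrow> 'z)
    \<Rightarrow> 'm measure \<Rightarrow> ('m \<Rightarrow> 'z \<Rightarrow> 'f) \<Rightarrow> bool" where
  "gelfand_integrable scl \<mu> \<psi> \<longleftrightarrow>
    \<psi> \<in> space \<mu> \<rightarrow> top_dual scl \<and> (\<forall>z. integrable \<mu> (\<lambda>x. \<psi> x z))"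

definition gelfand_integral ::
  "'m measure \<Rightarrow> 'm set \<Rightarrow> ('m \<Rightarrow> 'z \<Rightarrow> 'f::{real_normed_field, banach, second_countable_topology})
    \<Rightarrow> 'z \<Rightarrow> 'f" where
  "gelfand_integral \<mu> E \<psi> = (\<lambda>z. LINT x:E|\<mu>. \<psi> x z)"

text \<open>
  Maps from the underlying set of a measure space to the dual, as extensional functions, so that
  equality of such maps is equality on \<^term>\<open>space \<mu>\<close>.
\<close>

definition dual_maps ::
  "('f::real_normed_field \<Rightarrow> 'z::{topological_space, ab_group_add} \<Rightarrow> 'z)
    \<Rightarrow> 'm measure \<Rightarrow> ('m \<Rightarrow> 'z \<Rightarrow> 'f) set" where
  "dual_maps scl \<mu> = space \<mu> \<rightarrow>\<^sub>E top_dual scl"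

text \<open>
  The underlying measurable space is the one of the measure, i.e. \<^term>\<open>space \<mu>\<close> with
  \<^term>\<open>sets \<mu>\<close>. The functional \<open>u\<close> is the unit element.
\<close>

definition integrator ::
  "('f::{real_normed_field, banach, second_countable_topology}
      \<Rightarrow> 'z::{topological_space, ab_group_add} \<Rightarrow> 'z)
    \<Rightarrow> ('m set \<Rightarrow> 'z \<Rightarrow> 'f) \<Rightarrow> 'm measure
    \<Rightarrow> (('m \<Rightarrow> 'z \<Rightarrow> 'f) \<Rightarrow> ('m \<Rightarrow> 'z \<Rightarrow> 'f)) \<Rightarrow> bool" where
  "integrator scl \<xi> \<mu> \<Xi> \<longleftrightarrow>
    sigma_finite_measure \<mu> \<and>
    \<xi> \<in> sets \<mu> \<rightarrow> top_dual scl \<and>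
    \<Xi> \<in> dual_maps scl \<mu> \<rightarrow> dual_maps scl \<mu> \<and>
    (\<exists>u\<in>top_dual scl.
      gelfand_integrable scl \<mu> (\<Xi> (\<lambda>x\<in>space \<mu>. u)) \<and>
      (\<forall>E\<in>sets \<mu>. \<xi> E = gelfand_integral \<mu> E (\<Xi> (\<lambda>x\<in>space \<mu>. u))))"

text \<open>
  Integrability and the integral with respect to an integrator are determined by its measure
  and its map.
\<close>

definition integrator_integrable ::
  "('f::{real_normed_field, banach, second_countable_topology}
      \<Rightarrow> 'z::{topological_space, ab_group_add} \<Rightarrow> 'z)
    \<Rightarrow> 'm measure \<Rightarrow> (('m \<Rightarrow> 'z \<Rightarrow> 'f) \<Rightarrow> ('m \<Rightarrow> 'z \<Rightarrow> 'f)) \<Rightarrow> ('m \<Rightarrow> 'z \<Rightarrow> 'f) set" where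
  "integrator_integrable scl \<mu> \<Xi> =
    {\<gamma> \<in> dual_maps scl \<mu>. gelfand_integrable scl \<mu> (\<Xi> \<gamma>)}"

definition integrator_integral ::
  "'m measure \<Rightarrow> (('m \<Rightarrow> 'z \<Rightarrow> 'f) \<Rightarrow> ('m \<Rightarrow> 'z \<Rightarrow> 'f)) \<Rightarrow> 'm set \<Rightarrow> ('m \<Rightarrow> 'z \<Rightarrow> 'f)
    \<Rightarrow> 'z \<Rightarrow> 'f::{real_normed_field, banach, second_countable_topology}" where
  "integrator_integral \<mu> \<Xi> E \<gamma> = gelfand_integral \<mu> E (\<Xi> \<gamma>)"

end

theory Submission
  imports Defs
begin

text \<open>
  A \<open>\<sigma>\<close>-\<open>\<sigma>\<close>-continuous operator \<open>T\<close> on the dual is the transpose of a map on the space itself: for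
  every \<open>z\<close> the functional \<open>\<phi> \<mapsto> T \<phi> z\<close> is weak star continuous, hence is evaluation at some
  vector \<open>w\<close> (\<open>weak_star_operator_eq_evaluation\<close>). Consequently \<open>T\<close> may be pulled under a Gelfand
  integral: \<open>T (\<integral> \<psi>) z = (\<integral> \<psi>) w = \<integral> \<psi>(x) w = \<integral> T (\<psi>(x)) z\<close>
  (\<open>weak_star_operator_gelfand_integral\<close>).

  Applied to \<open>\<Xi>\<^sub>1\<^sub>,\<^sub>x\<close> and to \<open>\<Xi>\<^sub>2\<^sub>,\<^sub>y\<close>, this turns the two iterated integrals, evaluated at \<open>z\<close>, into the
  iterated scalar integrals of \<open>\<Xi>\<^sub>1\<^sub>,\<^sub>x (\<Xi>\<^sub>2\<^sub>,\<^sub>y (\<gamma>(x, y))) z\<close> and \<open>\<Xi>\<^sub>2\<^sub>,\<^sub>y (\<Xi>\<^sub>1\<^sub>,\<^sub>x (\<gamma>(x, y))) z\<close>. The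
  integrands agree because the operators commute, and the order of integration is exchanged by
  Fubini's theorem for the product measure.
\<close>

section \<open>The topological dual and its weak star topology\<close>

lemma top_dual_zero:
  assumes "vector_space scl"
  shows "(\<lambda>z. 0) \<in> top_dual scl"
  using assms vector_space_over_itself.vector_space_axioms
  by (auto simp: top_dual_def Vector_Spaces.linear_def module_hom_def module_hom_axioms_def
      vector_space_over_itself.module_axioms module_iff_vector_space)

lemma top_dual_add:
  assumes "\<phi> \<in> top_dual scl" "\<psi> \<in> top_dual scl"
  shows "(\<lambda>z. \<phi> z + \<psi> z) \<in> top_dual scl"
  using assms
  by (auto simp: top_dual_def Vector_Spaces.linear_def module_hom_def module_hom_axioms_def
      algebra_simps intro: continuous_on_add)

lemma top_dual_scale:
  assumes "\<phi> \<in> top_dual scl"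
  shows "(\<lambda>z. c * \<phi> z) \<in> top_dual scl"
  using assms
  by (auto simp: top_dual_def Vector_Spaces.linear_def module_hom_def module_hom_axioms_def
      algebra_simps intro: continuous_on_mult continuous_on_const)

lemma top_dual_linear_combination:
  assumes "\<phi> \<in> top_dual scl"
  shows "\<phi> (\<Sum>z\<in>F. scl (c z) z) = (\<Sum>z\<in>F. c z * \<phi> z)"
proof -
  from assms have "module_hom scl (*) \<phi>"
    by (simp add: top_dual_def Vector_Spaces.linear_def)
  then show ?thesis
    by (simp add: module_hom.sum module_hom.scale)
qed

lemma topspace_weak_star: "topspace (weak_star scl) = top_dual scl"
  unfolding weak_star_def topology_generated_by_topspace
  by (auto intro!: exI[of _ UNIV])

lemma weak_star_neighbourhood_of_zero:
  assumes "openin (weak_star scl) W" "(\<lambda>z. 0) \<in> W"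
  shows "\<exists>F \<epsilon>. finite F \<and> \<epsilon> > 0 \<and>
    (\<forall>\<phi>\<in>top_dual scl. (\<forall>z\<in>F. norm (\<phi> z) < \<epsilon>) \<longrightarrow> \<phi> \<in> W)"
proof -
  have "generate_topology_on {{\<phi> \<in> top_dual scl. \<phi> z \<in> U} | z U. open U} W"
    using assms(1) by (simp add: weak_star_def openin_topology_generated_by_iff)
  then show ?thesis
    using assms(2)
  proof (induction rule: generate_topology_on.induct)
    case Empty
    then show ?case by simp
  next
    case (Int A B)
    then obtain F \<epsilon> G \<delta> where
      "finite F" "\<epsilon> > 0" "\<forall>\<phi>\<in>top_dual scl. (\<forall>z\<in>F. norm (\<phi> z) < \<epsilon>) \<longrightarrow> \<phi> \<in> A"
      "finite G" "\<delta> > 0" "\<forall>\<phi>\<in>top_dual scl. (\<forall>z\<in>G. norm (\<phi> z) < \<delta>) \<longrightarrow> \<phi> \<in> B"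
      by blast
    then show ?case
      by (intro exI[of _ "F \<union> G"] exI[of _ "min \<epsilon> \<delta>"]) auto
  next
    case (UN K)
    then obtain A where "A \<in> K" "(\<lambda>z. 0) \<in> A" by blast
    with UN.IH[of A] show ?case by blast
  next
    case (Basis A)
    then obtain z U where A: "A = {\<phi> \<in> top_dual scl. \<phi> z \<in> U}" and "open U" "0 \<in> U"
      by auto
    then obtain \<epsilon> where "\<epsilon> > 0" "ball 0 \<epsilon> \<subseteq> U"
      using open_contains_ball by blast
    with A show ?case
      by (intro exI[of _ "{z}"] exI[of _ \<epsilon>]) (auto simp: subset_iff)
  qed
qed

section \<open>Weak star continuous operators as transposes\<close>

text \<open>
  For a space \<open>D\<close> of functions: a linear functional on \<open>D\<close> whose kernel contains the common kernel
  of finitely many evaluations is a linear combination of these evaluations.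
\<close>

lemma functional_eq_sum_of_evaluations:
  fixes D :: "('z \<Rightarrow> 'f::field) set" and L :: "('z \<Rightarrow> 'f) \<Rightarrow> 'f"
  assumes "finite F"
    and D_add: "\<And>\<phi> \<psi>. \<phi> \<in> D \<Longrightarrow> \<psi> \<in> D \<Longrightarrow> (\<lambda>z. \<phi> z + \<psi> z) \<in> D"
    and D_scale: "\<And>c \<phi>. \<phi> \<in> D \<Longrightarrow> (\<lambda>z. c * \<phi> z) \<in> D"
    and "\<And>\<phi> \<psi>. \<phi> \<in> D \<Longrightarrow> \<psi> \<in> D \<Longrightarrow> L (\<lambda>z. \<phi> z + \<psi> z) = L \<phi> + L \<psi>"
    and "\<And>c \<phi>. \<phi> \<in> D \<Longrightarrow> L (\<lambda>z. c * \<phi> z) = c * L \<phi>"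
    and "\<And>\<phi>. \<phi> \<in> D \<Longrightarrow> \<forall>z\<in>F. \<phi> z = 0 \<Longrightarrow> L \<phi> = 0"
  shows "\<exists>c. \<forall>\<phi>\<in>D. L \<phi> = (\<Sum>z\<in>F. c z * \<phi> z)"
  using assms(1,4-)
proof (induction F arbitrary: L rule: finite_induct)
  case empty
  then show ?case by simp
next
  case (insert w F)
  note L_add = insert.prems(1) and L_scale = insert.prems(2) and L_zero = insert.prems(3)
  show ?case
  proof (cases "\<forall>\<phi>\<in>D. (\<forall>z\<in>F. \<phi> z = 0) \<longrightarrow> \<phi> w = 0")
    case True
    then have "\<exists>c. \<forall>\<phi>\<in>D. L \<phi> = (\<Sum>z\<in>F. c z * \<phi> z)"
      by (intro insert.IH L_add L_scale L_zero) auto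
    then obtain c where c: "\<forall>\<phi>\<in>D. L \<phi> = (\<Sum>z\<in>F. c z * \<phi> z)" by blast
    have "(\<Sum>z\<in>insert w F. (c(w := 0)) z * \<phi> z) = (\<Sum>z\<in>F. c z * \<phi> z)" for \<phi>
      using insert.hyps by (simp, intro sum.cong) auto
    with c show ?thesis by metis
  next
    case False
    then obtain \<theta> where \<theta>: "\<theta> \<in> D" "\<forall>z\<in>F. \<theta> z = 0" "\<theta> w \<noteq> 0" by blast
    \<comment> \<open>Subtracting the multiple of evaluation at \<open>w\<close> that agrees with \<open>L\<close> at \<open>\<theta>\<close> leaves a
      functional to which the induction hypothesis applies.\<close>
    define a where "a = L \<theta> / \<theta> w"
    define L' where "L' \<phi> = L \<phi> - a * \<phi> w" for \<phi>
    have "\<exists>c. \<forall>\<phi>\<in>D. L' \<phi> = (\<Sum>z\<in>F. c z * \<phi> z)"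
    proof (rule insert.IH)
      fix \<phi> \<psi> assume "\<phi> \<in> D" "\<psi> \<in> D"
      then show "L' (\<lambda>z. \<phi> z + \<psi> z) = L' \<phi> + L' \<psi>"
        by (simp add: L'_def L_add algebra_simps)
    next
      fix k \<phi> assume "\<phi> \<in> D"
      then show "L' (\<lambda>z. k * \<phi> z) = k * L' \<phi>"
        by (simp add: L'_def L_scale algebra_simps)
    next
      fix \<phi> assume \<phi>: "\<phi> \<in> D" "\<forall>z\<in>F. \<phi> z = 0"
      define b where "b = - (\<phi> w / \<theta> w)"
      have "L (\<lambda>z. \<phi> z + b * \<theta> z) = 0"
        using \<phi> \<theta> by (intro L_zero D_add D_scale) (auto simp: b_def)
      moreover have "L (\<lambda>z. \<phi> z + b * \<theta> z) = L \<phi> + b * L \<theta>"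
        using \<phi>(1) \<theta>(1) by (simp add: L_add L_scale D_scale)
      ultimately show "L' \<phi> = 0"
        by (simp add: L'_def a_def b_def algebra_simps)
    qed
    then obtain c where c: "\<forall>\<phi>\<in>D. L' \<phi> = (\<Sum>z\<in>F. c z * \<phi> z)" by blast
    have "(\<Sum>z\<in>insert w F. (c(w := a)) z * \<phi> z) = a * \<phi> w + (\<Sum>z\<in>F. c z * \<phi> z)" for \<phi>
    proof -
      have "(\<Sum>z\<in>F. (c(w := a)) z * \<phi> z) = (\<Sum>z\<in>F. c z * \<phi> z)"
        using insert.hyps by (intro sum.cong) auto
      then show ?thesis using insert.hyps by simp
    qed
    with c have "\<forall>\<phi>\<in>D. L \<phi> = (\<Sum>z\<in>insert w F. (c(w := a)) z * \<phi> z)"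
      by (simp add: L'_def algebra_simps)
    then show ?thesis by blast
  qed
qed

lemma weak_star_operator_in_top_dual:
  assumes "T \<in> weak_star_operators scl" "\<phi> \<in> top_dual scl"
  shows "T \<phi> \<in> top_dual scl"
  using assms continuous_map_image_subset_topspace[of "weak_star scl" "weak_star scl" T]
  by (auto simp: weak_star_operators_def topspace_weak_star)

text \<open>
  Continuity of \<open>\<phi> \<mapsto> T \<phi> z\<close> at zero gives a finite set \<open>F\<close> such that \<open>T \<phi> z\<close> vanishes whenever \<open>\<phi>\<close>
  vanishes on \<open>F\<close>; so \<open>T \<phi> z\<close> is a linear combination of the values \<open>\<phi> y\<close>, \<open>y \<in> F\<close>, and \<open>w\<close> is the same
  linear combination of the vectors \<open>y\<close>.
\<close>

lemma weak_star_operator_eq_evaluation: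
  assumes vs: "vector_space scl" and T: "T \<in> weak_star_operators scl"
  obtains w where "\<And>\<phi>. \<phi> \<in> top_dual scl \<Longrightarrow> T \<phi> z = \<phi> w"
proof -
  have cont: "continuous_map (weak_star scl) (weak_star scl) T"
    and T_add: "\<And>\<phi> \<psi>. \<phi> \<in> top_dual scl \<Longrightarrow> \<psi> \<in> top_dual scl \<Longrightarrow>
      T (\<lambda>z. \<phi> z + \<psi> z) = (\<lambda>z. T \<phi> z + T \<psi> z)"
    and T_scale: "\<And>c \<phi>. \<phi> \<in> top_dual scl \<Longrightarrow> T (\<lambda>z. c * \<phi> z) = (\<lambda>z. c * T \<phi> z)"
    using T by (auto simp: weak_star_operators_def)
  define W where "W = {\<phi> \<in> top_dual scl. T \<phi> \<in> {\<psi> \<in> top_dual scl. \<psi> z \<in> ball 0 1}}"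
  have "openin (weak_star scl) {\<psi> \<in> top_dual scl. \<psi> z \<in> ball 0 1}"
    unfolding weak_star_def by (rule topology_generated_by_Basis) blast
  from openin_continuous_map_preimage[OF cont this] have "openin (weak_star scl) W"
    unfolding W_def topspace_weak_star .
  moreover have "(\<lambda>z. 0) \<in> W"
    using T_scale[OF top_dual_zero[OF vs], of 0] top_dual_zero[OF vs] by (simp add: W_def)
  ultimately obtain F \<epsilon> where "finite F" "\<epsilon> > 0"
    and W: "\<forall>\<phi>\<in>top_dual scl. (\<forall>z\<in>F. norm (\<phi> z) < \<epsilon>) \<longrightarrow> \<phi> \<in> W"
    using weak_star_neighbourhood_of_zero by blast
  have "T \<phi> z = 0" if \<phi>: "\<phi> \<in> top_dual scl" "\<forall>z\<in>F. \<phi> z = 0" for \<phi>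
  proof (rule ccontr)
    assume nz: "T \<phi> z \<noteq> 0"
    \<comment> \<open>All multiples of \<open>\<phi>\<close> lie in \<open>W\<close>, in particular the one that \<open>T\<close> sends to value \<open>1\<close> at \<open>z\<close>.\<close>
    have "(\<lambda>y. inverse (T \<phi> z) * \<phi> y) \<in> W"
      using W top_dual_scale[OF \<phi>(1)] \<phi>(2) \<open>\<epsilon> > 0\<close> by simp
    with nz T_scale[OF \<phi>(1)] show False
      by (simp add: W_def)
  qed
  then have "\<exists>c. \<forall>\<phi>\<in>top_dual scl. T \<phi> z = (\<Sum>y\<in>F. c y * \<phi> y)"
    using \<open>finite F\<close>
    by (intro functional_eq_sum_of_evaluations) (auto simp: T_add T_scale top_dual_add top_dual_scale)
  then obtain c where "\<forall>\<phi>\<in>top_dual scl. T \<phi> z = (\<Sum>y\<in>F. c y * \<phi> y)" by blast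
  then show ?thesis
    by (intro that[of "\<Sum>y\<in>F. scl (c y) y"]) (simp add: top_dual_linear_combination)
qed

section \<open>Operators under Gelfand integrals\<close>

text \<open>
  That the Gelfand integral lies in the dual is a hypothesis here; the scalar integrals involved
  need not even exist, since the two integrands coincide.
\<close>

lemma weak_star_operator_gelfand_integral:
  assumes "vector_space scl" "T \<in> weak_star_operators scl"
    and "\<psi> \<in> space \<mu> \<rightarrow> top_dual scl" "gelfand_integral \<mu> E \<psi> \<in> top_dual scl"
  shows "T (gelfand_integral \<mu> E \<psi>) = gelfand_integral \<mu> E (\<lambda>x. T (\<psi> x))"
proof
  fix z
  obtain w where w: "\<And>\<phi>. \<phi> \<in> top_dual scl \<Longrightarrow> T \<phi> z = \<phi> w"
    using weak_star_operator_eq_evaluation[OF assms(1,2)] by blast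
  have "T (gelfand_integral \<mu> E \<psi>) z = (LINT x:E|\<mu>. \<psi> x w)"
    using w[OF assms(4)] by (simp add: gelfand_integral_def)
  also have "\<dots> = (LINT x:E|\<mu>. T (\<psi> x) z)"
    unfolding set_lebesgue_integral_def
    using assms(3) by (intro Bochner_Integration.integral_cong) (auto simp: w Pi_iff)
  finally show "T (gelfand_integral \<mu> E \<psi>) z = gelfand_integral \<mu> E (\<lambda>x. T (\<psi> x)) z"
    by (simp add: gelfand_integral_def)
qed

lemma gelfand_integral_cong:
  assumes "\<And>x. x \<in> space \<mu> \<Longrightarrow> \<psi> x = \<psi>' x"
  shows "gelfand_integral \<mu> E \<psi> = gelfand_integral \<mu> E \<psi>'"
  unfolding gelfand_integral_def set_lebesgue_integral_def
  by (intro ext Bochner_Integration.integral_cong) (auto simp: assms)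

section \<open>Iterated integrals\<close>

lemma set_integral_Fubini:
  fixes f :: "'a \<Rightarrow> 'b \<Rightarrow> 'c::{banach, second_countable_topology}"
  assumes "sigma_finite_measure M" "sigma_finite_measure N"
    and "integrable (M \<Otimes>\<^sub>M N) (\<lambda>(x, y). f x y)"
    and "A \<in> sets M" "B \<in> sets N"
  shows "(LINT x:A|M. LINT y:B|N. f x y) = (LINT y:B|N. LINT x:A|M. f x y)"
proof -
  interpret pair_sigma_finite M N
    using assms(1,2) by (simp add: pair_sigma_finite_def)
  define g where "g x y = indicat_real A x *\<^sub>R indicat_real B y *\<^sub>R f x y" for x y
  have "integrable (M \<Otimes>\<^sub>M N) (\<lambda>p. indicat_real (A \<times> B) p *\<^sub>R (case p of (x, y) \<Rightarrow> f x y))"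
    using assms(3-5) by (intro integrable_mult_indicator) auto
  moreover have "indicat_real (A \<times> B) p *\<^sub>R (case p of (x, y) \<Rightarrow> f x y) = (case p of (x, y) \<Rightarrow> g x y)"
    for p
    by (auto simp: g_def indicator_def split: prod.split)
  ultimately have "integrable (M \<Otimes>\<^sub>M N) (\<lambda>(x, y). g x y)"
    by simp
  then have "(LINT y|N. LINT x|M. g x y) = (LINT x|M. LINT y|N. g x y)"
    by (rule Fubini_integral)
  moreover have "(LINT y|N. g x y) = indicat_real A x *\<^sub>R (LINT y:B|N. f x y)" for x
    by (cases "x \<in> A") (simp_all add: g_def set_lebesgue_integral_def)
  moreover have "(LINT x|M. g x y) = indicat_real B y *\<^sub>R (LINT x:A|M. f x y)" for y
    by (cases "y \<in> B") (simp_all add: g_def set_lebesgue_integral_def)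
  ultimately show ?thesis
    by (simp add: set_lebesgue_integral_def)
qed

text \<open>
  If two integrator maps act pointwise through weak star continuous operators, the iterated integral
  with respect to them is an iterated Gelfand integral.
\<close>

lemma iterated_integrator_integral:
  assumes "vector_space scl"
    and T: "\<And>x. x \<in> space \<mu> \<Longrightarrow> T x \<in> weak_star_operators scl"
    and S: "\<And>y. y \<in> space \<nu> \<Longrightarrow> S y \<in> weak_star_operators scl"
    and \<Xi>: "\<And>\<eta> x. \<eta> \<in> dual_maps scl \<mu> \<Longrightarrow> x \<in> space \<mu> \<Longrightarrow> \<Xi> \<eta> x = T x (\<eta> x)"
    and \<Theta>: "\<And>\<eta> y. \<eta> \<in> dual_maps scl \<nu> \<Longrightarrow> y \<in> space \<nu> \<Longrightarrow> \<Theta> \<eta> y = S y (\<eta> y)"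
    and \<gamma>: "\<And>x y. x \<in> space \<mu> \<Longrightarrow> y \<in> space \<nu> \<Longrightarrow> \<gamma> x y \<in> top_dual scl"
    and inner: "(\<lambda>x\<in>space \<mu>. integrator_integral \<nu> \<Theta> B (\<lambda>y\<in>space \<nu>. \<gamma> x y)) \<in> dual_maps scl \<mu>"
  shows "integrator_integral \<mu> \<Xi> A
      (\<lambda>x\<in>space \<mu>. integrator_integral \<nu> \<Theta> B (\<lambda>y\<in>space \<nu>. \<gamma> x y)) =
    gelfand_integral \<mu> A (\<lambda>x. gelfand_integral \<nu> B (\<lambda>y. T x (S y (\<gamma> x y))))"
  unfolding integrator_integral_def[of \<mu>]
proof (rule gelfand_integral_cong)
  fix x assume x: "x \<in> space \<mu>"
  have "(\<lambda>y\<in>space \<nu>. \<gamma> x y) \<in> dual_maps scl \<nu>"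
    using \<gamma> x by (auto simp: dual_maps_def)
  then have eq: "integrator_integral \<nu> \<Theta> B (\<lambda>y\<in>space \<nu>. \<gamma> x y) =
      gelfand_integral \<nu> B (\<lambda>y. S y (\<gamma> x y))"
    unfolding integrator_integral_def by (intro gelfand_integral_cong) (simp add: \<Theta>)
  have "gelfand_integral \<nu> B (\<lambda>y. S y (\<gamma> x y)) \<in> top_dual scl"
    using PiE_mem[OF inner[unfolded dual_maps_def] x] x by (simp add: eq)
  then have "T x (gelfand_integral \<nu> B (\<lambda>y. S y (\<gamma> x y))) =
      gelfand_integral \<nu> B (\<lambda>y. T x (S y (\<gamma> x y)))"
    using x by (intro weak_star_operator_gelfand_integral[OF assms(1) T])
      (auto intro: weak_star_operator_in_top_dual S \<gamma>)
  with eq x show "\<Xi> (\<lambda>x\<in>space \<mu>. integrator_integral \<nu> \<Theta> B (\<lambda>y\<in>space \<nu>. \<gamma> x y)) x =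
      gelfand_integral \<nu> B (\<lambda>y. T x (S y (\<gamma> x y)))"
    by (simp add: \<Xi>[OF inner])
qed

theorem proposition4p6:
  fixes scl :: "'f::{real_normed_field, banach, second_countable_topology}
      \<Rightarrow> 'z::{uniform_topological_group_add, ab_group_add} \<Rightarrow> 'z"
    and \<mu>1 :: "'a measure" and \<mu>2 :: "'b measure"
    and \<xi>1 :: "'a set \<Rightarrow> 'z \<Rightarrow> 'f" and \<xi>2 :: "'b set \<Rightarrow> 'z \<Rightarrow> 'f"
    and \<Xi>1 :: "('a \<Rightarrow> 'z \<Rightarrow> 'f) \<Rightarrow> ('a \<Rightarrow> 'z \<Rightarrow> 'f)"
    and \<Xi>2 :: "('b \<Rightarrow> 'z \<Rightarrow> 'f) \<Rightarrow> ('b \<Rightarrow> 'z \<Rightarrow> 'f)"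
    and T1 :: "'a \<Rightarrow> ('z \<Rightarrow> 'f) \<Rightarrow> ('z \<Rightarrow> 'f)"
    and T2 :: "'b \<Rightarrow> ('z \<Rightarrow> 'f) \<Rightarrow> ('z \<Rightarrow> 'f)"
    and \<gamma> :: "'a \<Rightarrow> 'b \<Rightarrow> 'z \<Rightarrow> 'f"
  assumes "frechet_space scl"
    and "integrator scl \<xi>1 \<mu>1 \<Xi>1"
    and "integrator scl \<xi>2 \<mu>2 \<Xi>2"
    and "\<And>x. x \<in> space \<mu>1 \<Longrightarrow> T1 x \<in> weak_star_operators scl"
    and "\<And>y. y \<in> space \<mu>2 \<Longrightarrow> T2 y \<in> weak_star_operators scl"
    and "\<And>\<eta> x. \<eta> \<in> dual_maps scl \<mu>1 \<Longrightarrow> x \<in> space \<mu>1 \<Longrightarrow> \<Xi>1 \<eta> x = T1 x (\<eta> x)"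
    and "\<And>\<eta> y. \<eta> \<in> dual_maps scl \<mu>2 \<Longrightarrow> y \<in> space \<mu>2 \<Longrightarrow> \<Xi>2 \<eta> y = T2 y (\<eta> y)"
    and "\<And>x y. x \<in> space \<mu>1 \<Longrightarrow> y \<in> space \<mu>2 \<Longrightarrow> \<gamma> x y \<in> top_dual scl"
    and "\<And>x. x \<in> space \<mu>1 \<Longrightarrow>
      (\<lambda>y\<in>space \<mu>2. \<gamma> x y) \<in> integrator_integrable scl \<mu>2 \<Xi>2"
    and "\<And>y. y \<in> space \<mu>2 \<Longrightarrow>
      (\<lambda>x\<in>space \<mu>1. \<gamma> x y) \<in> integrator_integrable scl \<mu>1 \<Xi>1"
    and "\<And>E2. E2 \<in> sets \<mu>2 \<Longrightarrow>
      (\<lambda>x\<in>space \<mu>1. integrator_integral \<mu>2 \<Xi>2 E2 (\<lambda>y\<in>space \<mu>2. \<gamma> x y))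
        \<in> integrator_integrable scl \<mu>1 \<Xi>1"
    and "\<And>E1. E1 \<in> sets \<mu>1 \<Longrightarrow>
      (\<lambda>y\<in>space \<mu>2. integrator_integral \<mu>1 \<Xi>1 E1 (\<lambda>x\<in>space \<mu>1. \<gamma> x y))
        \<in> integrator_integrable scl \<mu>2 \<Xi>2"
    and "\<And>x y. x \<in> space \<mu>1 \<Longrightarrow> y \<in> space \<mu>2 \<Longrightarrow>
      T1 x (T2 y (\<gamma> x y)) = T2 y (T1 x (\<gamma> x y))"
    and "gelfand_integrable scl (\<mu>1 \<Otimes>\<^sub>M \<mu>2) (\<lambda>(x, y). T1 x (T2 y (\<gamma> x y)))"
  shows "\<forall>E1\<in>sets \<mu>1. \<forall>E2\<in>sets \<mu>2.
    integrator_integral \<mu>1 \<Xi>1 E1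
      (\<lambda>x\<in>space \<mu>1. integrator_integral \<mu>2 \<Xi>2 E2 (\<lambda>y\<in>space \<mu>2. \<gamma> x y)) =
    integrator_integral \<mu>2 \<Xi>2 E2
      (\<lambda>y\<in>space \<mu>2. integrator_integral \<mu>1 \<Xi>1 E1 (\<lambda>x\<in>space \<mu>1. \<gamma> x y))"
proof (intro ballI)
  fix E1 E2 assume E: "E1 \<in> sets \<mu>1" "E2 \<in> sets \<mu>2"
  have vs: "vector_space scl"
    using assms(1) by (rule frechet_space.axioms(1))
  have sf: "sigma_finite_measure \<mu>1" "sigma_finite_measure \<mu>2"
    using assms(2,3) by (simp_all add: integrator_def)
  have "integrator_integral \<mu>1 \<Xi>1 E1
      (\<lambda>x\<in>space \<mu>1. integrator_integral \<mu>2 \<Xi>2 E2 (\<lambda>y\<in>space \<mu>2. \<gamma> x y)) =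
    gelfand_integral \<mu>1 E1 (\<lambda>x. gelfand_integral \<mu>2 E2 (\<lambda>y. T1 x (T2 y (\<gamma> x y))))"
    using assms(4-8) assms(11)[OF E(2)]
    by (intro iterated_integrator_integral[OF vs]) (simp_all add: integrator_integrable_def)
  also have "\<dots> = gelfand_integral \<mu>2 E2 (\<lambda>y. gelfand_integral \<mu>1 E1 (\<lambda>x. T1 x (T2 y (\<gamma> x y))))"
  proof
    fix z
    have "integrable (\<mu>1 \<Otimes>\<^sub>M \<mu>2) (\<lambda>(x, y). T1 x (T2 y (\<gamma> x y)) z)"
      using assms(14) by (simp add: gelfand_integrable_def case_prod_unfold)
    from set_integral_Fubini[OF sf this E]
    show "gelfand_integral \<mu>1 E1 (\<lambda>x. gelfand_integral \<mu>2 E2 (\<lambda>y. T1 x (T2 y (\<gamma> x y)))) z =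
        gelfand_integral \<mu>2 E2 (\<lambda>y. gelfand_integral \<mu>1 E1 (\<lambda>x. T1 x (T2 y (\<gamma> x y)))) z"
      by (simp add: gelfand_integral_def)
  qed
  also have "\<dots> = gelfand_integral \<mu>2 E2 (\<lambda>y. gelfand_integral \<mu>1 E1 (\<lambda>x. T2 y (T1 x (\<gamma> x y))))"
    by (intro gelfand_integral_cong) (simp add: assms(13))
  also have "\<dots> = integrator_integral \<mu>2 \<Xi>2 E2
      (\<lambda>y\<in>space \<mu>2. integrator_integral \<mu>1 \<Xi>1 E1 (\<lambda>x\<in>space \<mu>1. \<gamma> x y))"
    using assms(4-8) assms(12)[OF E(1)]
    by (intro iterated_integrator_integral[OF vs, symmetric])
      (simp_all add: integrator_integrable_def)
  finally show "integrator_integral \<mu>1 \<Xi>1 E1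
      (\<lambda>x\<in>space \<mu>1. integrator_integral \<mu>2 \<Xi>2 E2 (\<lambda>y\<in>space \<mu>2. \<gamma> x y)) =
    integrator_integral \<mu>2 \<Xi>2 E2
      (\<lambda>y\<in>space \<mu>2. integrator_integral \<mu>1 \<Xi>1 E1 (\<lambda>x\<in>space \<mu>1. \<gamma> x y))" .
qed

end
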